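(* Let $G$ be a finite bipartite graph with no isolated vertices in which every vertex has even degree, and let $D(G)$ denote the set of vertex degrees of $G$ and $\Delta(G)$ its maximum degree. Then $$\check s(G) \leq \sum_{d \in D(G)} \binom{\Delta(G)/2}{d/2}.$$
   Context: For a proper edge coloring $\varphi$ of a graph $G$, the palette $S(v,\varphi)$ of a vertex $v$ is the set of colors on the edges incident with $v$. The palette index $\check s(G)$ is the minimum, over all proper edge colorings $\varphi$ of $G$, of the number of distinct palettes $S(v,\varphi)$, $v\in V(G)$. *)

theory Defs
  imports Main
begin

text \<open>A finite simple graph is a vertex set \<open>V\<close> together with a set \<open>E\<close> of two-element subsets of \<open>V\<close>.\<close>

definition finite_simple_graph :: "'a set \<Rightarrow> 'a set set \<Rightarrow> bool" where
  "finite_simple_graph V E \<longleftrightarrow> finite V \<and> (\<forall>e\<in>E. e \<subseteq> V \<and> card e = 2)"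

definition bipartite :: "'a set \<Rightarrow> 'a set set \<Rightarrow> bool" where
  "bipartite V E \<longleftrightarrow>
     (\<exists>X Y. X \<union> Y = V \<and> X \<inter> Y = {} \<and> (\<forall>e\<in>E. \<exists>x\<in>X. \<exists>y\<in>Y. e = {x, y}))"

definition incident_edges :: "'a set set \<Rightarrow> 'a \<Rightarrow> 'a set set" where
  "incident_edges E v = {e \<in> E. v \<in> e}"

definition degree :: "'a set set \<Rightarrow> 'a \<Rightarrow> nat" where
  "degree E v = card (incident_edges E v)"

definition degree_set :: "'a set \<Rightarrow> 'a set set \<Rightarrow> nat set" where
  "degree_set V E = degree E ` V"

definition max_degree :: "'a set \<Rightarrow> 'a set set \<Rightarrow> nat" where
  "max_degree V E = Max (degree_set V E)"

definition proper_edge_coloring :: "'a set set \<Rightarrow> ('a set \<Rightarrow> nat) \<Rightarrow> bool" where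
  "proper_edge_coloring E \<phi> \<longleftrightarrow>
     (\<forall>e\<in>E. \<forall>f\<in>E. e \<noteq> f \<and> e \<inter> f \<noteq> {} \<longrightarrow> \<phi> e \<noteq> \<phi> f)"

definition palette :: "'a set set \<Rightarrow> ('a set \<Rightarrow> nat) \<Rightarrow> 'a \<Rightarrow> nat set" where
  "palette E \<phi> v = \<phi> ` incident_edges E v"

text \<open>Since the graphs are finite, colours in \<open>nat\<close> are no restriction, and the set below is
  nonempty, so that the infimum is an attained minimum.\<close>

definition palette_index :: "'a set \<Rightarrow> 'a set set \<Rightarrow> nat" where
  "palette_index V E = Inf {card (palette E \<phi> ` V) | \<phi>. proper_edge_coloring E \<phi>}"

lemma palette_index_attained:
  assumes "finite_simple_graph V E"
  shows "\<exists>\<phi>. proper_edge_coloring E \<phi> \<and> card (palette E \<phi> ` V) = palette_index V E"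
proof -
  have "E \<subseteq> Pow V" "finite V"
    using assms by (auto simp: finite_simple_graph_def)
  then have "finite E"
    by (meson finite_Pow_iff finite_subset)
  then obtain \<phi> :: "'a set \<Rightarrow> nat" where "inj_on \<phi> E"
    using finite_imp_inj_to_nat_seg by blast
  then have "proper_edge_coloring E \<phi>"
    by (auto simp: proper_edge_coloring_def inj_on_def)
  then have "{card (palette E \<phi> ` V) | \<phi>. proper_edge_coloring E \<phi>} \<noteq> {}"
    by blast
  from Inf_nat_def1[OF this] show ?thesis
    by (auto simp: palette_index_def)
qed

end

theory Submission imports Defs begin

text \<open>Let \<open>G\<close> have parts \<open>X\<close>, \<open>Y\<close> and maximum degree \<open>2k\<close>. Pairing up the edges at every vertex
  gives two fixed-point-free involutions of the edge set, and their common alternating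
  2-colouring is an Eulerian orientation of \<open>G\<close>. Adding loops makes this digraph
  \<open>k\<close>-in- and \<open>k\<close>-out-regular, so it decomposes into \<open>k\<close> permutations of the vertices. An edge of
  permutation \<open>i\<close> gets colour \<open>2i\<close> if it is oriented from \<open>X\<close> to \<open>Y\<close> and \<open>2i + 1\<close> otherwise.
  Both colours are present at \<open>v\<close> if permutation \<open>i\<close> moves \<open>v\<close>, and neither is if it fixes \<open>v\<close>, so a
  palette at a vertex of degree \<open>d\<close> amounts to a \<open>d/2\<close>-subset of the \<open>k\<close> permutations.\<close>

section \<open>Pairings of edges and Euler splitting\<close>

text \<open>A partition of \<open>S\<close> into pairs, encoded as the map to the partner.\<close>

definition fpf_involution_on :: "'b set \<Rightarrow> ('b \<Rightarrow> 'b) \<Rightarrow> bool" where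
  "fpf_involution_on S \<alpha> \<longleftrightarrow> (\<forall>e\<in>S. \<alpha> e \<in> S \<and> \<alpha> e \<noteq> e \<and> \<alpha> (\<alpha> e) = e)"

text \<open>A multigraph is an edge set \<open>S\<close> with two end maps \<open>f\<close> and
  \<open>g\<close>, and fibres are its stars. Reading \<open>f\<close> as tail and \<open>g\<close>
  as head gives a digraph, or equally a bipartite multigraph on two copies of \<open>V\<close>;
  parallel edges and loops are allowed.\<close>

definition fibre :: "'b set \<Rightarrow> ('b \<Rightarrow> 'c) \<Rightarrow> 'c \<Rightarrow> 'b set" where
  "fibre S f a = {e \<in> S. f e = a}"

lemma finite_fibre: "finite S \<Longrightarrow> finite (fibre S f a)"
  by (simp add: fibre_def)

lemma even_fibres_involution:
  assumes "finite S" "\<And>a. even (card (fibre S f a))"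
  shows "\<exists>\<alpha>. fpf_involution_on S \<alpha> \<and> (\<forall>e\<in>S. f (\<alpha> e) = f e)"
  using assms
proof (induction S rule: finite_psubset_induct)
  case (psubset S)
  show ?case
  proof (cases "S = {}")
    case True
    then show ?thesis by (auto simp: fpf_involution_on_def)
  next
    case False
    then obtain e where e: "e \<in> S" by blast
    \<comment> \<open>An even fibre cannot be a singleton, so \<open>e\<close> has a mate in
      it.\<close>
    have "fibre S f (f e) \<noteq> {e}"
      using psubset.prems[of "f e"] by auto
    then obtain e' where e': "e' \<in> S" "e' \<noteq> e" "f e' = f e"
      using e by (auto simp: fibre_def)
    let ?S = "S - {e, e'}"
    have "even (card (fibre ?S f a))" for a
    proof (cases "a = f e")
      case True
      have "fibre S f a = insert e (insert e' (fibre ?S f a))"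
        using e e' True by (auto simp: fibre_def)
      moreover have "card (insert e (insert e' (fibre ?S f a))) = card (fibre ?S f a) + 2"
        using e' psubset.hyps by (subst card_insert_disjoint; auto simp: fibre_def)+
      ultimately show ?thesis
        using psubset.prems[of a] by simp
    next
      case False
      then have "fibre ?S f a = fibre S f a"
        using e' by (auto simp: fibre_def)
      then show ?thesis using psubset.prems[of a] by simp
    qed
    moreover have "?S \<subset> S" using e by blast
    ultimately obtain \<alpha> where \<alpha>: "fpf_involution_on ?S \<alpha>" "\<forall>d\<in>?S. f (\<alpha> d) = f d"
      using psubset.IH by meson
    have "fpf_involution_on S (\<alpha>(e := e', e' := e))" "\<forall>d\<in>S. f ((\<alpha>(e := e', e' := e)) d) = f d"
      using \<alpha> e e' by (auto simp: fpf_involution_on_def)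
    then show ?thesis by blast
  qed
qed

text \<open>The two pairings form cycles that alternate between \<alpha> and \<beta>, hence have
  even length. The induction removes one \<alpha>-pair at a time, so no cycle has to be
  constructed.\<close>

lemma common_alternating_colouring:
  assumes "finite S" "fpf_involution_on S \<alpha>" "fpf_involution_on S \<beta>"
  shows "\<exists>c :: 'b \<Rightarrow> bool. \<forall>e\<in>S. c (\<alpha> e) = (\<not> c e) \<and> c (\<beta> e) = (\<not> c e)"
  using assms
proof (induction S arbitrary: \<beta> rule: finite_psubset_induct)
  case (psubset S)
  note inv = psubset.prems[unfolded fpf_involution_on_def]
  show ?case
  proof (cases "S = {}")
    case True
    then show ?thesis by auto
  next
    case False
    then obtain e where e: "e \<in> S" by blast
    define a where "a = \<alpha> e"
    define b where "b = \<beta> e"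
    define d where "d = \<beta> a"
    let ?S = "S - {e, a}"
    have sub: "?S \<subset> S" using e by blast
    have a: "a \<in> S" "a \<noteq> e" "\<alpha> a = e" using inv e by (auto simp: a_def)
    have b: "b \<in> S" "b \<noteq> e" "\<beta> b = e" using inv e by (auto simp: b_def)
    have d: "d \<in> S" "d \<noteq> a" "\<beta> d = a" using inv a by (auto simp: d_def)
    have \<alpha>: "fpf_involution_on ?S \<alpha>"
      unfolding fpf_involution_on_def using inv a a_def by (metis Diff_iff insert_iff empty_iff)
    show ?thesis
    proof (cases "a = b")
      case True
      \<comment> \<open>Here \<open>e\<close> and \<open>a\<close> are partners in both pairings: a
        closed component, coloured independently of the rest.\<close>
      have "fpf_involution_on ?S \<beta>"
        unfolding fpf_involution_on_def using inv a b b_def True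
        by (metis Diff_iff insert_iff empty_iff)
      then obtain c where c: "\<forall>x\<in>?S. c (\<alpha> x) = (\<not> c x) \<and> c (\<beta> x) = (\<not> c x)"
        using psubset.IH[OF sub \<alpha>] by blast
      have "\<forall>x\<in>?S. \<alpha> x \<in> ?S \<and> \<beta> x \<in> ?S"
        using \<alpha> \<open>fpf_involution_on ?S \<beta>\<close> by (auto simp: fpf_involution_on_def)
      then have "\<forall>x\<in>S. (c(e := True, a := False)) (\<alpha> x) = (\<not> (c(e := True, a := False)) x)
          \<and> (c(e := True, a := False)) (\<beta> x) = (\<not> (c(e := True, a := False)) x)"
        using c a b True a_def b_def by auto
      then show ?thesis by blast
    next
      case False
      \<comment> \<open>Contract the path \<open>b - e - a - d\<close> to a single \<open>\<beta>\<close>-edge between \<open>b\<close> and \<open>d\<close>.\<close>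
      have ne: "d \<noteq> e" "d \<noteq> b" using a b d False b_def d_def by metis+
      let ?\<beta> = "\<beta>(b := d, d := b)"
      have \<beta>': "\<beta> x \<in> S - {e, a, b, d}" if "x \<in> S - {e, a, b, d}" for x
        using that inv b d b_def d_def by (metis Diff_iff insert_iff empty_iff)
      have \<beta>: "fpf_involution_on ?S ?\<beta>"
        unfolding fpf_involution_on_def
      proof
        fix x assume x: "x \<in> ?S"
        show "?\<beta> x \<in> ?S \<and> ?\<beta> x \<noteq> x \<and> ?\<beta> (?\<beta> x) = x"
        proof (cases "x = b \<or> x = d")
          case True
          then show ?thesis using ne a b d False by auto
        next
          case False
          then show ?thesis using \<beta>'[of x] x inv by auto
        qed
      qed
      obtain c where c: "\<forall>x\<in>?S. c (\<alpha> x) = (\<not> c x) \<and> c (?\<beta> x) = (\<not> c x)"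
        using psubset.IH[OF sub \<alpha> \<beta>] by blast
      have bd: "c d = (\<not> c b)"
        using c[rule_format, of b] b ne False by auto
      \<comment> \<open>The contracted edge forces opposite colours on \<open>b\<close> and
        \<open>d\<close>, so giving \<open>e\<close> the colour of \<open>d\<close> and
        \<open>a\<close> that of \<open>b\<close> restores alternation along the path.\<close>
      let ?c = "c(e := c d, a := c b)"
      have "?c (\<alpha> x) = (\<not> ?c x) \<and> ?c (\<beta> x) = (\<not> ?c x)" if x: "x \<in> S" for x
      proof -
        consider "x = e" | "x = a" | "x \<in> ?S" "x = b" | "x \<in> ?S" "x = d"
          | "x \<in> S - {e, a, b, d}" using x by blast
        then show ?thesis
        proof cases
          case 1
          then show ?thesis using a b bd False ne by (simp add: a_def[symmetric] b_def[symmetric])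
        next
          case 2
          then show ?thesis using a b d bd False ne by (simp add: d_def[symmetric])
        next
          case 3
          then have "\<alpha> x \<in> ?S" using \<alpha> unfolding fpf_involution_on_def by blast
          moreover have "c (\<alpha> x) = (\<not> c x)" using 3 c by blast
          moreover have "\<beta> x = e" using 3 b by simp
          ultimately show ?thesis using 3 a(2) bd by simp
        next
          case 4
          then have "\<alpha> x \<in> ?S" using \<alpha> unfolding fpf_involution_on_def by blast
          moreover have "c (\<alpha> x) = (\<not> c x)" using 4 c by blast
          moreover have "\<beta> x = a" using 4 d by simp
          ultimately show ?thesis using 4 a(2) bd by simp
        next
          case 5
          then have "x \<in> ?S" by blast
          then have "\<alpha> x \<in> ?S" "c (\<alpha> x) = (\<not> c x)" "c (?\<beta> x) = (\<not> c x)"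
            using \<alpha> c unfolding fpf_involution_on_def by blast+
          then show ?thesis using 5 \<beta>'[OF 5] by simp
        qed
      qed
      then show ?thesis by blast
    qed
  qed
qed

text \<open>\<alpha> preserves fibres and flips \<open>c\<close>, so it is a bijection between the
  two halves of each fibre.\<close>

lemma alternating_halves_fibre:
  assumes "finite S" "fpf_involution_on S \<alpha>" "\<forall>e\<in>S. f (\<alpha> e) = f e"
    "\<forall>e\<in>S. c (\<alpha> e) = (\<not> c e)"
  shows "card (fibre S f a) = 2 * card (fibre {e \<in> S. c e} f a)"
    and "card (fibre S f a) = 2 * card (fibre {e \<in> S. \<not> c e} f a)"
proof -
  let ?A = "fibre {e \<in> S. c e} f a" and ?B = "fibre {e \<in> S. \<not> c e} f a"
  have "bij_betw \<alpha> ?A ?B"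
    by (rule bij_betw_byWitness[where f' = \<alpha>])
      (use assms in \<open>auto simp: fpf_involution_on_def fibre_def\<close>)
  then have "card ?A = card ?B" by (rule bij_betw_same_card)
  moreover have "card (fibre S f a) = card ?A + card ?B"
    using assms(1) by (subst card_Un_disjoint[symmetric]) (auto simp: fibre_def intro!: arg_cong[where f=card])
  ultimately show "card (fibre S f a) = 2 * card ?A" "card (fibre S f a) = 2 * card ?B"
    by auto
qed

text \<open>Euler splitting: pair the edges at each end, and let \<open>T\<close> be one class of
  the common alternating colouring.\<close>

lemma halve_fibres:
  assumes "finite S" "\<And>a. even (card (fibre S f a))" "\<And>b. even (card (fibre S g b))"
  obtains T where "T \<subseteq> S"
    "\<And>a. card (fibre S f a) = 2 * card (fibre T f a)"
    "\<And>a. card (fibre S f a) = 2 * card (fibre (S - T) f a)"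
    "\<And>b. card (fibre S g b) = 2 * card (fibre T g b)"
    "\<And>b. card (fibre S g b) = 2 * card (fibre (S - T) g b)"
proof -
  obtain \<alpha> where \<alpha>: "fpf_involution_on S \<alpha>" "\<forall>e\<in>S. f (\<alpha> e) = f e"
    using even_fibres_involution[OF assms(1,2)] by blast
  obtain \<beta> where \<beta>: "fpf_involution_on S \<beta>" "\<forall>e\<in>S. g (\<beta> e) = g e"
    using even_fibres_involution[OF assms(1,3)] by blast
  obtain c where c: "\<forall>e\<in>S. c (\<alpha> e) = (\<not> c e) \<and> c (\<beta> e) = (\<not> c e)"
    using common_alternating_colouring[OF assms(1) \<alpha>(1) \<beta>(1)] by blast
  have "S - {e \<in> S. c e} = {e \<in> S. \<not> c e}" by blast
  then show thesis
    using that[of "{e \<in> S. c e}"] c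
      alternating_halves_fibre[OF assms(1) \<alpha>, of c] alternating_halves_fibre[OF assms(1) \<beta>, of c]
    by auto
qed

section \<open>Perfect matchings in regular bipartite multigraphs\<close>

text \<open>Each Euler splitting halves the degree, and one of the two halves also meets the halved
  bound on edges of \<open>B\<close>. After \<open>t\<close> splittings the degree is 1 and fewer
  than one edge of \<open>B\<close> is left.\<close>

lemma perfect_matching_avoiding:
  assumes "finite S" "f ` S \<subseteq> V" "g ` S \<subseteq> V"
    and "\<And>v. v \<in> V \<Longrightarrow> card (fibre S f v) = 2 ^ t"
    and "\<And>v. v \<in> V \<Longrightarrow> card (fibre S g v) = 2 ^ t"
    and "card (B \<inter> S) < 2 ^ t"
  shows "\<exists>M \<subseteq> S - B. \<forall>v\<in>V. card (fibre M f v) = 1 \<and> card (fibre M g v) = 1"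
  using assms
proof (induction t arbitrary: S)
  case 0
  then have "B \<inter> S = {}" by simp
  then show ?case using 0 by (intro exI[of _ S]) auto
next
  case (Suc t)
  \<comment> \<open>Splitting asks for even fibres everywhere; those outside \<open>V\<close> are
    empty.\<close>
  have ev: "even (card (fibre S h v))" if "h ` S \<subseteq> V" "\<And>v. v \<in> V \<Longrightarrow> card (fibre S h v) = 2 ^ Suc t" for h v
  proof (cases "v \<in> V")
    case False
    then have "fibre S h v = {}" using that by (auto simp: fibre_def)
    then show ?thesis by simp
  qed (use that in auto)
  obtain T where T: "T \<subseteq> S"
    "\<And>a. card (fibre S f a) = 2 * card (fibre T f a)"
    "\<And>a. card (fibre S f a) = 2 * card (fibre (S - T) f a)"
    "\<And>b. card (fibre S g b) = 2 * card (fibre T g b)"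
    "\<And>b. card (fibre S g b) = 2 * card (fibre (S - T) g b)"
    using halve_fibres[of S f g, OF Suc.prems(1) ev[OF Suc.prems(2,4)] ev[OF Suc.prems(3,5)]]
    by blast
  have "card (B \<inter> S) = card (B \<inter> T) + card (B \<inter> (S - T))"
    using T(1) Suc.prems(1) finite_subset[OF T(1)]
    by (subst card_Un_disjoint[symmetric]) (auto intro!: arg_cong[where f=card])
  \<comment> \<open>If both counts were at least \<open>2 ^ t\<close>, then \<open>S\<close> would
    contain at least \<open>2 ^ Suc t\<close> edges of \<open>B\<close>.\<close>
  then consider "card (B \<inter> T) < 2 ^ t" | "card (B \<inter> (S - T)) < 2 ^ t"
    using Suc.prems(6) by fastforce
  then obtain U where "U = T \<or> U = S - T" "card (B \<inter> U) < 2 ^ t" by blast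
  then have U: "U \<subseteq> S" "card (B \<inter> U) < 2 ^ t"
    "\<And>a. card (fibre S f a) = 2 * card (fibre U f a)"
    "\<And>a. card (fibre S g a) = 2 * card (fibre U g a)"
    using T by auto
  have "\<exists>M \<subseteq> U - B. \<forall>v\<in>V. card (fibre M f v) = 1 \<and> card (fibre M g v) = 1"
  proof (rule Suc.IH)
    show "card (fibre U f v) = 2 ^ t" "card (fibre U g v) = 2 ^ t" if "v \<in> V" for v
      using U(3,4)[of v] Suc.prems(4,5)[OF that] by auto
  qed (use U(1,2) Suc.prems(1,2,3) finite_subset[OF U(1)] in blast)+
  then show ?case using U(1) by blast
qed

text \<open>Alon's argument: with \<open>2 ^ t = q * k + r\<close>, take \<open>q\<close> copies of every edge together with
  \<open>r\<close> dummy edges at every vertex. The dummy edges number fewer than \<open>2 ^ t\<close> once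
  \<open>k * card V \<le> 2 ^ t\<close>.\<close>

lemma regular_perfect_matching:
  fixes S :: "'b set" and V :: "'c set"
  assumes "finite S" "finite V" "f ` S \<subseteq> V" "g ` S \<subseteq> V" "k > 0"
    and "\<And>v. v \<in> V \<Longrightarrow> card (fibre S f v) = k"
    and "\<And>v. v \<in> V \<Longrightarrow> card (fibre S g v) = k"
  shows "\<exists>M \<subseteq> S. \<forall>v\<in>V. card (fibre M f v) = 1 \<and> card (fibre M g v) = 1"
proof -
  obtain t :: nat where t: "k * card V < 2 ^ t" using less_exp by blast
  define q where "q = (2::nat) ^ t div k"
  define r where "r = (2::nat) ^ t mod k"
  let ?B = "Inr ` (V \<times> {..<r}) :: ('b \<times> nat + 'c \<times> nat) set"
  let ?S = "Inl ` (S \<times> {..<q}) \<union> ?B"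
  \<comment> \<open>The lift of either end map sends a dummy to its base vertex, so dummies are
    loops.\<close>
  let ?l = "\<lambda>h. case_sum (\<lambda>p. h (fst p)) fst :: 'b \<times> nat + 'c \<times> nat \<Rightarrow> 'c"
  have card: "card (fibre ?S (?l h) v) = 2 ^ t"
    if "v \<in> V" "card (fibre S h v) = k" for h v
  proof -
    have "fibre ?S (?l h) v = Inl ` (fibre S h v \<times> {..<q}) \<union> Inr ` ({v} \<times> {..<r})"
      using that by (auto simp: fibre_def)
    also have "card \<dots> = k * q + r"
      using that
      by (subst card_Un_disjoint)
        (auto simp: finite_fibre[OF assms(1)] card_image card_cartesian_product)
    finally show ?thesis by (simp add: q_def r_def)
  qed
  have "?B \<inter> ?S = ?B" by blast
  moreover have "card ?B = card V * r" by (simp add: card_image card_cartesian_product)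
  \<comment> \<open>\<open>r\<close> is a remainder modulo \<open>k\<close>, so the count is at most
    \<open>k * card V\<close>.\<close>
  moreover have "card V * r < 2 ^ t"
    using assms(5) t by (intro le_less_trans[OF _ t]) (simp add: r_def mult.commute)
  ultimately have few: "card (?B \<inter> ?S) < 2 ^ t" using t by simp
  have "\<exists>N \<subseteq> ?S - ?B. \<forall>v\<in>V. card (fibre N (?l f) v) = 1 \<and> card (fibre N (?l g) v) = 1"
  proof (rule perfect_matching_avoiding[OF _ _ _ _ _ few])
    show "?l f ` ?S \<subseteq> V" "?l g ` ?S \<subseteq> V" using assms(3,4) by auto
  qed (use assms card in simp_all)
  then obtain N where N: "N \<subseteq> ?S - ?B"
    "\<forall>v\<in>V. card (fibre N (?l f) v) = 1 \<and> card (fibre N (?l g) v) = 1" by blast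
  let ?p = "\<lambda>x. fst (projl x) :: 'b"
  have sub: "N \<subseteq> Inl ` (S \<times> {..<q})" using N(1) by blast
  \<comment> \<open>\<open>N\<close> contains only copies of edges of \<open>S\<close>; forgetting
    the copy number maps its single edge at \<open>v\<close> to a single edge of
    \<open>S\<close>.\<close>
  have one: "card (fibre (?p ` N) h v) = 1" if single: "card (fibre N (?l h) v) = 1" for h v
  proof -
    have "fibre (?p ` N) h v = ?p ` fibre N (?l h) v"
      using sub by (fastforce simp: fibre_def)
    moreover obtain x where "fibre N (?l h) v = {x}"
      using single card_1_singletonE by blast
    ultimately show ?thesis by simp
  qed
  have "?p ` N \<subseteq> S" using sub by auto
  then show ?thesis using one N(2) by (intro exI[of _ "?p ` N"]) blast
qed

section \<open>Edge colourings of regular and balanced digraphs\<close>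

text \<open>Perfect matchings, peeled off one at a time, are the colour classes. That every star
  sees all of \<open>{..<k}\<close> allows passing to complements of loop colours later.\<close>

lemma regular_edge_colouring:
  assumes "finite S" "finite V" "f ` S \<subseteq> V" "g ` S \<subseteq> V"
    and "\<And>v. v \<in> V \<Longrightarrow> card (fibre S f v) = k"
    and "\<And>v. v \<in> V \<Longrightarrow> card (fibre S g v) = k"
  shows "\<exists>c :: 'b \<Rightarrow> nat. \<forall>v\<in>V. bij_betw c (fibre S f v) {..<k} \<and> bij_betw c (fibre S g v) {..<k}"
  using assms
proof (induction k arbitrary: S)
  case 0
  then have "\<forall>v\<in>V. fibre S f v = {} \<and> fibre S g v = {}" by (simp add: finite_fibre)
  then show ?case by (simp add: bij_betw_def)
next
  case (Suc k)
  obtain M where M: "M \<subseteq> S" "\<forall>v\<in>V. card (fibre M f v) = 1 \<and> card (fibre M g v) = 1"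
    using regular_perfect_matching[of S V f g "Suc k"] Suc.prems by auto
  have dif: "fibre (S - M) h v = fibre S h v - fibre M h v" for h v
    by (auto simp: fibre_def)
  have sub: "fibre M h v \<subseteq> fibre S h v" for h v
    using M(1) by (auto simp: fibre_def)
  have "\<exists>c :: 'b \<Rightarrow> nat. \<forall>v\<in>V. bij_betw c (fibre (S - M) f v) {..<k}
      \<and> bij_betw c (fibre (S - M) g v) {..<k}"
    by (rule Suc.IH)
      (use Suc.prems M in \<open>auto simp: dif card_Diff_subset sub finite_subset[OF sub finite_fibre]\<close>)
  then obtain c :: "'b \<Rightarrow> nat" where c: "\<forall>v\<in>V. bij_betw c (fibre (S - M) f v) {..<k}
      \<and> bij_betw c (fibre (S - M) g v) {..<k}" by blast
  let ?c = "\<lambda>e. if e \<in> M then k else c e"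
  have ext: "bij_betw ?c (fibre S h v) {..<Suc k}"
    if "bij_betw c (fibre (S - M) h v) {..<k}" "card (fibre M h v) = 1" for h v
  proof -
    obtain m where m: "fibre M h v = {m}" using \<open>card _ = 1\<close> card_1_singletonE by blast
    then have mM: "m \<in> M" by (auto simp: fibre_def)
    have "bij_betw ?c (fibre (S - M) h v) {..<k}"
      using that(1) by (rule bij_betw_cong[THEN iffD1, rotated]) (auto simp: fibre_def)
    moreover have "bij_betw ?c {m} {k}" using mM by (simp add: bij_betw_def)
    ultimately have "bij_betw ?c (fibre (S - M) h v \<union> {m}) ({..<k} \<union> {k})"
      by (rule bij_betw_combine) auto
    moreover have "fibre (S - M) h v \<union> {m} = fibre S h v"
      using m sub[of h v] by (auto simp: dif)
    moreover have "{..<k} \<union> {k} = {..<Suc k}" by auto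
    ultimately show ?thesis by simp
  qed
  show ?case
    by (intro exI[of _ ?c] ballI conjI ext) (use c M(2) in auto)
qed

text \<open>Loops raise every out- and in-degree to \<open>k\<close>. A loop lies in both the out- and the in-fibre
  of its vertex, so the colours left for the original arcs are the same on both sides.\<close>

lemma balanced_arc_colouring:
  fixes S :: "'b set" and V :: "'c set"
  assumes "finite S" "finite V" "f ` S \<subseteq> V" "g ` S \<subseteq> V"
    and bal: "\<And>v. v \<in> V \<Longrightarrow> card (fibre S f v) = card (fibre S g v)"
    and le: "\<And>v. v \<in> V \<Longrightarrow> card (fibre S f v) \<le> k"
  shows "\<exists>c :: 'b \<Rightarrow> nat. \<forall>v\<in>V. inj_on c (fibre S f v) \<and> inj_on c (fibre S g v)
    \<and> c ` fibre S f v = c ` fibre S g v \<and> c ` fibre S f v \<subseteq> {..<k}"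
proof -
  let ?L = "\<lambda>v. {v} \<times> {..<k - card (fibre S f v)}"
  let ?S = "Inl ` S \<union> Inr ` (\<Union>v\<in>V. ?L v) :: ('b + 'c \<times> nat) set"
  let ?l = "\<lambda>h. case_sum h fst :: 'b + 'c \<times> nat \<Rightarrow> 'c"
  have fib: "fibre ?S (?l h) v = Inl ` fibre S h v \<union> Inr ` ?L v" if "v \<in> V" for h v
    using that by (auto simp: fibre_def)
  have card: "card (fibre ?S (?l h) v) = k" if "v \<in> V" "card (fibre S h v) = card (fibre S f v)" for h v
    unfolding fib[OF that(1)] using that le[OF that(1)] 
    by (subst card_Un_disjoint) (auto simp: finite_fibre[OF assms(1)] card_image card_cartesian_product)
  have "\<exists>c :: 'b + 'c \<times> nat \<Rightarrow> nat. \<forall>v\<in>V. bij_betw c (fibre ?S (?l f) v) {..<k}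
      \<and> bij_betw c (fibre ?S (?l g) v) {..<k}"
    by (rule regular_edge_colouring) (use assms card in auto)
  then obtain c :: "'b + 'c \<times> nat \<Rightarrow> nat" where
    c: "\<And>v. v \<in> V \<Longrightarrow> bij_betw c (fibre ?S (?l f) v) {..<k}"
       "\<And>v. v \<in> V \<Longrightarrow> bij_betw c (fibre ?S (?l g) v) {..<k}" by blast
  have part: "inj_on (c \<circ> Inl) (fibre S h v)" "(c \<circ> Inl) ` fibre S h v = {..<k} - c ` Inr ` ?L v"
    if "v \<in> V" "bij_betw c (fibre ?S (?l h) v) {..<k}" for h v
  proof -
    have inj: "inj_on c (Inl ` fibre S h v \<union> Inr ` ?L v)"
      and im: "c ` (Inl ` fibre S h v \<union> Inr ` ?L v) = {..<k}"
      using that(2) unfolding fib[OF that(1)] bij_betw_def by blast+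
    show "inj_on (c \<circ> Inl) (fibre S h v)"
      using inj by (auto simp: inj_on_Un intro: comp_inj_on)
    \<comment> \<open>Injectivity separates arc colours from loop colours at \<open>v\<close>, so
      the former are the complement of the latter.\<close>
    have "c ` Inl ` fibre S h v \<inter> c ` Inr ` ?L v = {}"
      using inj_on_image_Int[OF inj, of "Inl ` fibre S h v" "Inr ` ?L v"] by auto
    then show "(c \<circ> Inl) ` fibre S h v = {..<k} - c ` Inr ` ?L v"
      unfolding im[symmetric] image_Un image_comp[symmetric] by blast
  qed
  show ?thesis
    using part c by (intro exI[of _ "c \<circ> Inl"] ballI conjI) auto
qed

section \<open>Palettes of the coloured Eulerian orientation\<close>

theorem theorem2p2:
  fixes V :: "'a set" and E :: "'a set set"
  assumes "finite_simple_graph V E"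
    and "bipartite V E"
    and "\<forall>v\<in>V. degree E v \<noteq> 0"
    and "\<forall>v\<in>V. even (degree E v)"
  shows "palette_index V E \<le>
    (\<Sum>d\<in>degree_set V E. (max_degree V E div 2) choose (d div 2))"
proof -
  define k where "k = max_degree V E div 2"
  have finV: "finite V" and "E \<subseteq> Pow V"
    using assms(1) by (auto simp: finite_simple_graph_def)
  then have finE: "finite E" by (meson finite_Pow_iff finite_subset)
  obtain X Y where XY: "X \<union> Y = V" "X \<inter> Y = {}" "\<forall>e\<in>E. \<exists>x\<in>X. \<exists>y\<in>Y. e = {x, y}"
    using assms(2) unfolding bipartite_def by blast
  then obtain p r where pr: "\<And>e. e \<in> E \<Longrightarrow> p e \<in> X \<and> r e \<in> Y \<and> e = {p e, r e}"
    by metis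
  have side: "p e \<in> X" "p e \<notin> Y" "r e \<in> Y" "r e \<notin> X" if "e \<in> E" for e
    using pr[OF that] XY(2) by blast+
  have incX: "incident_edges E v = fibre E p v" if "v \<in> X" for v
  proof -
    have "v \<in> e \<longleftrightarrow> p e = v" if "e \<in> E" for e
      using \<open>v \<in> X\<close> pr[OF that] XY(2) by (metis disjoint_iff insert_iff empty_iff)
    then show ?thesis by (auto simp: incident_edges_def fibre_def)
  qed
  have incY: "incident_edges E v = fibre E r v" if "v \<in> Y" for v
  proof -
    have "v \<in> e \<longleftrightarrow> r e = v" if "e \<in> E" for e
      using \<open>v \<in> Y\<close> pr[OF that] XY(2) by (metis disjoint_iff insert_iff empty_iff)
    then show ?thesis by (auto simp: incident_edges_def fibre_def)
  qed
  have evp: "even (card (fibre E p v))" for v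
  proof (cases "v \<in> X")
    case True
    then show ?thesis using assms(4) incX[OF True] XY(1) by (metis UnI1 degree_def)
  next
    case False
    then have "fibre E p v = {}" using pr by (auto simp: fibre_def)
    then show ?thesis by simp
  qed
  have evr: "even (card (fibre E r v))" for v
  proof (cases "v \<in> Y")
    case True
    then show ?thesis using assms(4) incY[OF True] XY(1) by (metis UnI2 degree_def)
  next
    case False
    then have "fibre E r v = {}" using pr by (auto simp: fibre_def)
    then show ?thesis by simp
  qed
  obtain T where T: "T \<subseteq> E"
    "\<And>a. card (fibre E p a) = 2 * card (fibre T p a)"
    "\<And>a. card (fibre E p a) = 2 * card (fibre (E - T) p a)"
    "\<And>b. card (fibre E r b) = 2 * card (fibre T r b)"
    "\<And>b. card (fibre E r b) = 2 * card (fibre (E - T) r b)"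
    using halve_fibres[OF finE evp evr] by blast
  \<comment> \<open>Orienting \<open>T\<close> from \<open>X\<close> to \<open>Y\<close> and the other edges from \<open>Y\<close> to \<open>X\<close> is Eulerian.\<close>
  define s where "s e = (if e \<in> T then p e else r e)" for e
  define h where "h e = (if e \<in> T then r e else p e)" for e
  \<comment> \<open>\<open>s\<close> is the tail and \<open>h\<close> the head. Out- and in-stars at
    \<open>v\<close> are its edges inside and outside \<open>T\<close>, in an order decided by the
    side of \<open>v\<close>.\<close>
  have fibX: "fibre E s v = fibre T p v" "fibre E h v = fibre (E - T) p v" if "v \<in> X" for v
    using that T(1) by (auto simp: fibre_def s_def h_def dest: side)
  have fibY: "fibre E s v = fibre (E - T) r v" "fibre E h v = fibre T r v" if "v \<in> Y" for v
    using that T(1) by (auto simp: fibre_def s_def h_def dest: side)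
  have cards: "card (fibre E s v) = degree E v div 2" "card (fibre E h v) = degree E v div 2"
    if "v \<in> V" for v
  proof -
    have "v \<in> X \<or> v \<in> Y" using that XY(1) by blast
    then show "card (fibre E s v) = degree E v div 2" "card (fibre E h v) = degree E v div 2"
      using fibX[of v] fibY[of v] T(2,3)[of v] T(4,5)[of v] incX[of v] incY[of v]
      by (auto simp: degree_def)
  qed
  have lek: "degree E v div 2 \<le> k" if "v \<in> V" for v
    using that finV unfolding k_def max_degree_def degree_set_def
    by (intro div_le_mono Max_ge) auto
  have "\<exists>c :: 'a set \<Rightarrow> nat. \<forall>v\<in>V. inj_on c (fibre E s v) \<and> inj_on c (fibre E h v)
      \<and> c ` fibre E s v = c ` fibre E h v \<and> c ` fibre E s v \<subseteq> {..<k}"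
  proof (rule balanced_arc_colouring[OF finE finV])
    show "s ` E \<subseteq> V" "h ` E \<subseteq> V"
      using side(1,3) XY(1) by (auto simp: s_def h_def)
  qed (simp_all add: cards lek)
  then obtain c :: "'a set \<Rightarrow> nat" where
    col: "\<forall>v\<in>V. inj_on c (fibre E s v) \<and> inj_on c (fibre E h v)
      \<and> c ` fibre E s v = c ` fibre E h v \<and> c ` fibre E s v \<subseteq> {..<k}" ..
  have c: "inj_on c (fibre E s v)" "inj_on c (fibre E h v)"
    "c ` fibre E s v = c ` fibre E h v" "c ` fibre E s v \<subseteq> {..<k}" if "v \<in> V" for v
    using bspec[OF col that] by blast+
  define \<phi> where "\<phi> e = 2 * c e + (if e \<in> T then 0 else 1)" for e
  have inc: "v \<in> e \<longleftrightarrow> s e = v \<or> h e = v" if "e \<in> E" for v e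
  proof -
    have "v \<in> e \<longleftrightarrow> v = p e \<or> v = r e"
      using pr[OF that] by (metis insert_iff empty_iff)
    then show ?thesis by (auto simp: s_def h_def)
  qed
  have proper: "proper_edge_coloring E \<phi>"
    unfolding proper_edge_coloring_def
  proof (intro ballI impI notI)
    fix e e' assume e: "e \<in> E" "e' \<in> E" "e \<noteq> e' \<and> e \<inter> e' \<noteq> {}" and eq: "\<phi> e = \<phi> e'"
    \<comment> \<open>The parity of \<open>\<phi> e\<close> tells whether \<open>e\<close> is in
      \<open>T\<close>, and the quotient by 2 is \<open>c e\<close>.\<close>
    have par: "c e = c e'" "e \<in> T \<longleftrightarrow> e' \<in> T"
      using eq unfolding \<phi>_def by (auto split: if_splits) presburger+
    obtain v where v: "v \<in> e" "v \<in> e'" using e by blast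
    then have vV: "v \<in> V" using e(1) \<open>E \<subseteq> Pow V\<close> by blast
    \<comment> \<open>Both edges cross the bipartition in the same direction, so at \<open>v\<close>
      both leave or both enter.\<close>
    have "s e = v \<and> s e' = v \<or> h e = v \<and> h e' = v"
      using inc[OF e(1), of v] inc[OF e(2), of v] v par(2) side[OF e(1)] side[OF e(2)]
      unfolding s_def h_def by (auto split: if_splits)
    then have "e = e'"
      using c(1,2)[OF vV] e(1,2) par(1) by (auto simp: fibre_def dest: inj_onD)
    then show False using e by blast
  qed
  define P where "P C = (\<lambda>i. 2 * i) ` C \<union> (\<lambda>i. 2 * i + 1) ` C" for C :: "nat set"
  let ?A = "\<lambda>d. {C. C \<subseteq> {..<k} \<and> card C = d div 2}"
  have pal: "palette E \<phi> v = P (c ` fibre E s v)" if v: "v \<in> V" for v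
  proof -
    have split: "incident_edges E v = fibre E s v \<union> fibre E h v"
      using inc by (auto simp: incident_edges_def fibre_def)
    \<comment> \<open>One of the two stars thus receives only even colours and the other only odd
      ones, over the same set of values of \<open>c\<close>.\<close>
    have "(fibre E s v \<subseteq> T \<and> fibre E h v \<inter> T = {}) \<or> (fibre E s v \<inter> T = {} \<and> fibre E h v \<subseteq> T)"
      using v XY(1) fibX[of v] fibY[of v] by (auto simp: fibre_def)
    then show ?thesis
    proof
      assume a: "fibre E s v \<subseteq> T \<and> fibre E h v \<inter> T = {}"
      have "\<phi> ` fibre E s v = (\<lambda>i. 2 * i) ` c ` fibre E s v"
        using a unfolding image_image \<phi>_def by (intro image_cong) auto
      moreover have "\<phi> ` fibre E h v = (\<lambda>i. 2 * i + 1) ` c ` fibre E h v"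
        using a unfolding image_image \<phi>_def by (intro image_cong) auto
      ultimately show ?thesis
        unfolding palette_def split image_Un P_def using c(3)[OF v] by simp
    next
      assume a: "fibre E s v \<inter> T = {} \<and> fibre E h v \<subseteq> T"
      have "\<phi> ` fibre E s v = (\<lambda>i. 2 * i + 1) ` c ` fibre E s v"
        using a unfolding image_image \<phi>_def by (intro image_cong) auto
      moreover have "\<phi> ` fibre E h v = (\<lambda>i. 2 * i) ` c ` fibre E h v"
        using a unfolding image_image \<phi>_def by (intro image_cong) auto
      ultimately show ?thesis
        unfolding palette_def split image_Un P_def using c(3)[OF v] by auto
    qed
  qed
  \<comment> \<open>The out-degree is half the degree and \<open>c\<close> is injective on the
    out-star, so each palette is the image under \<open>P\<close> of a subset of
    \<open>{..<k}\<close> of that size.\<close>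
  have "c ` fibre E s v \<in> ?A (degree E v)" if "v \<in> V" for v
    using c(1,4)[OF that] cards(1)[OF that] by (simp add: card_image)
  then have sub: "palette E \<phi> ` V \<subseteq> P ` (\<Union>d\<in>degree_set V E. ?A d)"
    using pal unfolding degree_set_def by blast
  have finD: "finite (degree_set V E)" using finV by (simp add: degree_set_def)
  have "palette_index V E \<le> card (palette E \<phi> ` V)"
    unfolding palette_index_def by (rule wellorder_Inf_le1) (use proper in blast)
  also have "\<dots> \<le> card (P ` (\<Union>d\<in>degree_set V E. ?A d))"
    by (rule card_mono[OF _ sub]) (use finD in auto)
  also have "\<dots> \<le> card (\<Union>d\<in>degree_set V E. ?A d)"
    by (rule card_image_le) (use finD in auto)
  also have "\<dots> \<le> (\<Sum>d\<in>degree_set V E. card (?A d))"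
    by (rule card_UN_le[OF finD])
  also have "\<dots> = (\<Sum>d\<in>degree_set V E. k choose (d div 2))"
    by (simp add: n_subsets)
  finally show ?thesis by (simp add: k_def)
qed

end
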